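(* Let $G$ be the augmented multigraph of a fixed connected network with $v$ tensor vertices and $R$ edges, minimum cut $s$, and let $Q$ be its flow quotient, as defined in the context. Put $C_0=1+4R$. For integers $p\ge2$ and $M,N\ge1$ with $p^{4v}M^{C_0}<N$, $$F_G(p,N)\le\frac{F_Q(p,M)}{1-p^{4v}M^{C_0}/N}.$$ In particular, with $K_G=4v+2+8R$, $$F_G(p,N)\le\frac{F_Q(p,p^2)}{1-p^{K_G}/N}\qquad(N>p^{K_G}).$$
   Context: Network: a fixed finite connected loopless multigraph of tensor vertices $V_G$ ($v=|V_G|$), with parallel edges allowed, together with nonempty sets $A$ (output) and $B$ (input) of open legs, each attached to a tensor vertex. The augmented multigraph $G$ is obtained by attaching all input legs to a terminal $\mathsf b$ and all output legs to a terminal $\mathsf a$; $R=|E(G)|$ counts internal edges plus open legs; $s\ge1$ is the minimum size of an edge cut separating $\mathsf b$ from $\mathsf a$ (legs may be cut). Moment polynomial: on $S_p$ put $\gamma_p=(1\,2\cdots p)$, $|\sigma|=p-\#\mathrm{cycles}(\sigma)$, $d(\sigma,\tau)=|\sigma^{-1}\tau|$. For labels $\pi\in S_p^{V_G}$ with $\pi_{\mathsf b}=\mathrm{id}$, $\pi_{\mathsf a}=\gamma_p$, set $$\mathcal H_G^{(p)}(\pi)=\sum_{\{u,w\}\in E(G)}d(\pi_u,\pi_w),\quad \Delta_G(\pi)=\mathcal H_G^{(p)}(\pi)-s(p-1),\quad A_G(p,\delta)=\#\{\pi:\Delta_G(\pi)=\delta\},$$ $$F_G(p,N)=\sum_{\delta\ge0}A_G(p,\delta)N^{-\delta}.$$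 (Edges are counted with multiplicity; $\Delta_G\ge0$ always. $F_G(p,N)$ equals $\mathbb E[N^{-s}\operatorname{tr}Y_N^p]$ for $Y_N=N^{s-R}H_NH_N^*$, where $H_N$ is the contraction of the network with independent standard complex Gaussian tensors and all edge dimensions $N$.) Flow quotient: fix a maximum family of $s$ edge-disjoint simple paths from $\mathsf b$ to $\mathsf a$ in $G$. Form a directed graph $D$ on $V_G\cup\{\mathsf a,\mathsf b\}$ by orienting each edge used by the paths forward along its path, and replacing each unused edge by both arcs. Let $Q$ be the multigraph obtained by contracting each full strongly connected component of $D$ to a vertex, discarding edges inside components and retaining edges of $G$ between different components with multiplicity. The components containing $\mathsf b$ and $\mathsf a$ are distinct and are the terminals of $Q$. $F_Q(p,M)$ is defined just as $F_G$: label the nonterminal vertices of $Q$ by elements of $S_p$, label the component of $\mathsf b$ by $\mathrm{id}$ and that of $\mathsf a$ by $\gamma_p$, let $\mathcal H_Q^{(p)}$ be the sum of $d$ over the edges of $Q$ with multiplicity, $\Delta_Q=\mathcal H_Q^{(p)}-s(p-1)$ (with the same $s$, which is also the minimum terminal cut of $Q$), $A_Q(p,\delta)$ the number of labelings with $\Delta_Q=\delta$, and $F_Q(p,M)=\sum_{\delta\ge0}A_Q(p,\delta)M^{-\delta}$. *)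

theory Defs
  imports
    "Graph_Theory.Graph_Theory"
    "HOL-Combinatorics.Cycles"
    "HOL-Combinatorics.Orbits"
begin

text \<open>
  A finite undirected multigraph is represented by a \<^typ>\<open>('v, 'e) pre_digraph\<close>: the arcs are the
  edges (so parallel edges are distinct arcs), and the \<^const>\<open>tail\<close> and \<^const>\<open>head\<close> of an arc are
  the two endpoints of the edge, listed in an arbitrary order that carries no meaning. Undirected
  walks are directed walks in the bidirected graph, whose arc \<^term>\<open>(e, True)\<close> traverses \<^term>\<open>e\<close>
  from tail to head and whose arc \<^term>\<open>(e, False)\<close> traverses it from head to tail.
\<close>

definition bidirected :: "('v, 'e) pre_digraph \<Rightarrow> ('v, 'e \<times> bool) pre_digraph" where
  "bidirected G =
    \<lparr> verts = verts G,
      arcs = arcs G \<times> UNIV,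
      tail = (\<lambda>(e, fwd). if fwd then tail G e else head G e),
      head = (\<lambda>(e, fwd). if fwd then head G e else tail G e) \<rparr>"

section \<open>Tensor networks\<close>

locale tensor_network = fin_digraph T + loopfree_digraph T
  for T :: "('v, 'e) pre_digraph" +
  fixes A :: "'o set" and out_at :: "'o \<Rightarrow> 'v"
    and B :: "'i set" and in_at :: "'i \<Rightarrow> 'v"
  assumes connected_network: "Digraph_Component.connected T"
    and finite_legs: "finite A" "finite B"
    and nonempty_legs: "A \<noteq> {}" "B \<noteq> {}"
    and out_at_verts: "x \<in> A \<Longrightarrow> out_at x \<in> verts T"
    and in_at_verts: "y \<in> B \<Longrightarrow> in_at y \<in> verts T"

datatype 'v aug_vert = Tensor 'v | Term_a | Term_b

datatype ('e, 'o, 'i) aug_edge = Internal 'e | Out_Leg 'o | In_Leg 'i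

definition augmented ::
  "('v, 'e) pre_digraph \<Rightarrow> 'o set \<Rightarrow> ('o \<Rightarrow> 'v) \<Rightarrow> 'i set \<Rightarrow> ('i \<Rightarrow> 'v)
    \<Rightarrow> ('v aug_vert, ('e, 'o, 'i) aug_edge) pre_digraph" where
  "augmented T A out_at B in_at =
    \<lparr> verts = Tensor ` verts T \<union> {Term_a, Term_b},
      arcs = Internal ` arcs T \<union> Out_Leg ` A \<union> In_Leg ` B,
      tail = (\<lambda>x. case x of Internal e \<Rightarrow> Tensor (tail T e)
                          | Out_Leg l \<Rightarrow> Tensor (out_at l)
                          | In_Leg l \<Rightarrow> Term_b),
      head = (\<lambda>x. case x of Internal e \<Rightarrow> Tensor (head T e)
                          | Out_Leg l \<Rightarrow> Term_a
                          | In_Leg l \<Rightarrow> Tensor (in_at l)) \<rparr>"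

section \<open>Minimum cuts and the flow quotient\<close>

definition separating_cut :: "('v, 'e) pre_digraph \<Rightarrow> 'v \<Rightarrow> 'v \<Rightarrow> 'e set \<Rightarrow> bool" where
  "separating_cut G b a C \<longleftrightarrow>
     C \<subseteq> arcs G \<and> \<not> reachable (bidirected (G\<lparr>arcs := arcs G - C\<rparr>)) b a"

definition min_cut :: "('v, 'e) pre_digraph \<Rightarrow> 'v \<Rightarrow> 'v \<Rightarrow> nat" where
  "min_cut G b a = (LEAST k. \<exists>C. separating_cut G b a C \<and> card C = k)"

definition edge_disjoint_paths ::
  "('v, 'e) pre_digraph \<Rightarrow> 'v \<Rightarrow> 'v \<Rightarrow> ('e \<times> bool) list set \<Rightarrow> bool" where
  "edge_disjoint_paths G b a P \<longleftrightarrow>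
     (\<forall>w\<in>P. pre_digraph.apath (bidirected G) b w a) \<and>
     pairwise (\<lambda>w w'. disjnt (fst ` set w) (fst ` set w')) P"

definition flow_digraph ::
  "('v, 'e) pre_digraph \<Rightarrow> ('e \<times> bool) list set \<Rightarrow> ('v, 'e \<times> bool) pre_digraph" where
  "flow_digraph G P =
    (let used = (\<Union>w\<in>P. set w)
     in (bidirected G)\<lparr>arcs := used \<union> (arcs G - fst ` used) \<times> UNIV\<rparr>)"

definition flow_component ::
  "('v, 'e) pre_digraph \<Rightarrow> ('e \<times> bool) list set \<Rightarrow> 'v \<Rightarrow> 'v set" where
  "flow_component G P u = pre_digraph.scc_of (flow_digraph G P) u"

definition flow_quotient ::
  "('v, 'e) pre_digraph \<Rightarrow> ('e \<times> bool) list set \<Rightarrow> ('v set, 'e) pre_digraph" where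
  "flow_quotient G P =
    \<lparr> verts = pre_digraph.sccs_verts (flow_digraph G P),
      arcs = {e \<in> arcs G. flow_component G P (tail G e) \<noteq> flow_component G P (head G e)},
      tail = (\<lambda>e. flow_component G P (tail G e)),
      head = (\<lambda>e. flow_component G P (head G e)) \<rparr>"

section \<open>Moment polynomials\<close>

text \<open>
  The symmetric group on \<open>p\<close> letters consists of the functions permuting \<^term>\<open>{1..p}\<close>. The cycles of
  such a function, fixed points included, are its orbits on \<^term>\<open>{1..p}\<close>.
\<close>

definition full_cycle :: "nat \<Rightarrow> nat \<Rightarrow> nat" where
  "full_cycle p = cycle_of_list [1..<Suc p]"

definition perm_length :: "nat \<Rightarrow> (nat \<Rightarrow> nat) \<Rightarrow> nat" where
  "perm_length p \<sigma> = p - card (orbit \<sigma> ` {1..p})"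

definition perm_dist :: "nat \<Rightarrow> (nat \<Rightarrow> nat) \<Rightarrow> (nat \<Rightarrow> nat) \<Rightarrow> nat" where
  "perm_dist p \<sigma> \<tau> = perm_length p (inv \<sigma> \<circ> \<tau>)"

definition labelings ::
  "('v, 'e) pre_digraph \<Rightarrow> 'v \<Rightarrow> 'v \<Rightarrow> nat \<Rightarrow> ('v \<Rightarrow> nat \<Rightarrow> nat) set" where
  "labelings G b a p =
    {\<pi> \<in> verts G \<rightarrow>\<^sub>E {\<sigma>. \<sigma> permutes {1..p}}. \<pi> b = id \<and> \<pi> a = full_cycle p}"

definition label_energy :: "('v, 'e) pre_digraph \<Rightarrow> nat \<Rightarrow> ('v \<Rightarrow> nat \<Rightarrow> nat) \<Rightarrow> nat" where
  "label_energy G p \<pi> = (\<Sum>e\<in>arcs G. perm_dist p (\<pi> (tail G e)) (\<pi> (head G e)))"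

definition label_defect ::
  "('v, 'e) pre_digraph \<Rightarrow> nat \<Rightarrow> nat \<Rightarrow> ('v \<Rightarrow> nat \<Rightarrow> nat) \<Rightarrow> int" where
  "label_defect G s p \<pi> = int (label_energy G p \<pi>) - int s * (int p - 1)"

definition defect_count ::
  "('v, 'e) pre_digraph \<Rightarrow> 'v \<Rightarrow> 'v \<Rightarrow> nat \<Rightarrow> nat \<Rightarrow> nat \<Rightarrow> nat" where
  "defect_count G b a s p \<delta> = card {\<pi> \<in> labelings G b a p. label_defect G s p \<pi> = int \<delta>}"

text \<open>On a finite multigraph only finitely many terms of the following series are nonzero.\<close>

definition moment_poly ::
  "('v, 'e) pre_digraph \<Rightarrow> 'v \<Rightarrow> 'v \<Rightarrow> nat \<Rightarrow> nat \<Rightarrow> nat \<Rightarrow> real" where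
  "moment_poly G b a s p N = (\<Sum>\<delta>. real (defect_count G b a s p \<delta>) / real N ^ \<delta>)"

end

theory Submission
  imports Defs
begin

text \<open>
  Write \<open>d\<close> for \<^const>\<open>perm_dist\<close>, which is the word metric on the symmetric group with respect to all
  transpositions, and \<open>s\<close> for the minimum cut. The idea is that a labeling of small defect is nearly
  constant on every strongly connected component of the flow digraph, so that it is a small
  perturbation of a labeling of the quotient, and that there are few such perturbations.

  Give a vertex labelled \<open>\<sigma>\<close> the height \<open>d(id, \<sigma>)\<close>. The height is \<open>0\<close> at \<open>b\<close> and
  \<open>p - 1\<close> at \<open>a\<close>. Let the excess of an arc of the flow digraph be its \<open>d\<close>-length minus its gain in height; it is
  nonnegative by the triangle inequality. Along a flow path the gains telescope to \<open>p - 1\<close>, so the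
  excesses on all \<open>s\<close> paths together with the lengths of the unused edges add up to the defect
  \<open>\<delta>\<close>. The two arcs of an unused edge have opposite gains, so their excesses add up to twice its
  length. Hence the excess over the whole flow digraph is at most \<open>2 \<delta>\<close> (\<open>sum_excess_le\<close>).

  If \<open>u\<close> and \<open>v\<close> lie in one strongly connected component, simple directed paths from \<open>u\<close> to \<open>v\<close>
  and back give \<open>d(\<pi> u, \<pi> v) \<le> 2 \<delta> + (height v - height u)\<close> and the same with \<open>u\<close> and \<open>v\<close>
  exchanged. The height terms cancel in the sum, and \<open>d(\<pi> u, \<pi> v) \<le> 2 \<delta>\<close>
  (\<open>dist_le_twice_defect\<close>).

  Collapse a labeling \<open>\<pi>\<close> of \<open>G\<close> to the quotient by reading it off at one representative of each
  component, where the representatives of the terminal components are the terminals. Every label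
  moves by at most \<open>2 \<delta>\<close>, every edge length therefore by at most \<open>4 \<delta>\<close>, and the defect of the
  collapsed labeling is at most \<open>(1 + 4 R) \<delta>\<close> (\<open>label_defect_collapse\<close>). Conversely, a ball of
  radius \<open>2 \<delta>\<close> contains at most \<open>p ^ (4 \<delta>)\<close> permutations (\<open>card_perm_dist_ball\<close>), so a
  labeling of the quotient comes from at most \<open>p ^ (4 v \<delta>)\<close> labelings of defect \<open>\<delta>\<close>
  (\<open>card_collapse_fibre\<close>). Weighting a labeling of the quotient of defect \<open>\<epsilon> \<le> (1 + 4 R) \<delta>\<close> by
  \<open>M ^ ((1 + 4 R) \<delta> - \<epsilon>) \<ge> 1\<close> bounds the \<open>\<delta>\<close>-th coefficient of the moment polynomial of \<open>G\<close> by
  \<open>(p ^ (4 v) M ^ (1 + 4 R)) ^ \<delta>\<close> times the moment polynomial of the quotient at \<open>M\<close>, and a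
  geometric series finishes the proof.
\<close>

section \<open>Lengths of permutations\<close>

definition invariant_sets :: "'a set \<Rightarrow> ('a \<Rightarrow> 'a) \<Rightarrow> 'a set set" where
  "invariant_sets A \<sigma> = {S. S \<subseteq> A \<and> \<sigma> ` S = S}"

lemma finite_invariant_sets: "finite A \<Longrightarrow> finite (invariant_sets A \<sigma>)"
  by (rule finite_subset[of _ "Pow A"]) (auto simp: invariant_sets_def)

lemma invariant_setsI:
  assumes "finite A" "\<sigma> permutes A" "S \<subseteq> A" "\<sigma> ` S \<subseteq> S"
  shows "S \<in> invariant_sets A \<sigma>"
proof -
  have "inj_on \<sigma> S" using assms(2) by (rule permutes_inj_on)
  then have "\<sigma> ` S = S"
    by (rule endo_inj_surj[OF finite_subset[OF assms(3,1)] assms(4)])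
  then show ?thesis using assms(3) by (simp add: invariant_sets_def)
qed

text \<open>
  The invariant sets are the unions of orbits. This turns statements about the number of cycles into
  statements about the lattice of invariant sets, where products of permutations are easy to handle.
\<close>

lemma card_invariant_sets:
  assumes A: "finite A" and \<sigma>: "\<sigma> permutes A"
  shows "card (invariant_sets A \<sigma>) = 2 ^ card (orbit \<sigma> ` A)"
proof -
  have self: "x \<in> orbit \<sigma> x" for x
    using A \<sigma> permutation_permutes permutation_self_in_orbit by metis
  have "bij_betw \<Union> (Pow (orbit \<sigma> ` A)) (invariant_sets A \<sigma>)"
  proof (rule bij_betw_byWitness[where f' = "\<lambda>S. orbit \<sigma> ` S"])
    show "\<forall>O'\<in>Pow (orbit \<sigma> ` A). orbit \<sigma> ` \<Union> O' = O'"
    proof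
      fix O' assume O': "O' \<in> Pow (orbit \<sigma> ` A)"
      have eq: "orbit \<sigma> y = S" if "S \<in> O'" "y \<in> S" for S y
        using that O' cyclic_on_orbit[OF \<sigma> A] by (auto intro!: orbit_cyclic_eq3)
      moreover have "\<exists>y. y \<in> S" if "S \<in> O'" for S
        using that O' self by auto
      ultimately show "orbit \<sigma> ` \<Union> O' = O'" by (force simp: image_iff)
    qed
    have *: "orbit \<sigma> x \<subseteq> S" if "S \<in> invariant_sets A \<sigma>" "x \<in> S" for S x
    proof
      fix y assume "y \<in> orbit \<sigma> x"
      then show "y \<in> S"
        by induct (use that in \<open>auto simp: invariant_sets_def\<close>)
    qed
    then show "\<forall>S\<in>invariant_sets A \<sigma>. \<Union> (orbit \<sigma> ` S) = S"
      using self by blast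
    show "\<Union> ` Pow (orbit \<sigma> ` A) \<subseteq> invariant_sets A \<sigma>"
    proof safe
      fix O' assume O': "O' \<subseteq> orbit \<sigma> ` A"
      show "\<Union> O' \<in> invariant_sets A \<sigma>"
      proof (rule invariant_setsI[OF A \<sigma>])
        show "\<Union> O' \<subseteq> A" using O' permutes_orbit_subset[OF \<sigma>] by blast
        show "\<sigma> ` \<Union> O' \<subseteq> \<Union> O'" using O' by (auto intro: orbit.step)
      qed
    qed
    show "(`) (orbit \<sigma>) ` invariant_sets A \<sigma> \<subseteq> Pow (orbit \<sigma> ` A)"
      by (auto simp: invariant_sets_def)
  qed
  from bij_betw_same_card[OF this] show ?thesis
    using A by (simp add: card_Pow)
qed

lemma invariant_sets_inv:
  assumes "\<sigma> permutes A"
  shows "invariant_sets A (inv \<sigma>) = invariant_sets A \<sigma>"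
proof -
  have "inv \<sigma> ` S = S \<longleftrightarrow> \<sigma> ` S = S" for S
    using permutes_bij[OF assms] by (metis bij_is_inj bij_is_surj image_inv_f_f image_f_inv_f)
  then show ?thesis by (simp add: invariant_sets_def)
qed

lemma card_le_card_mult_fibres:
  assumes "finite S" "finite T" "g ` S \<subseteq> T"
    and "\<And>y. y \<in> T \<Longrightarrow> card {x \<in> S. g x = y} \<le> k"
  shows "card S \<le> card T * k"
proof -
  have "card S = (\<Sum>y\<in>T. card {x \<in> S. g x = y})"
    using sum.group[OF assms(1-3), of "\<lambda>_. 1 :: nat"] by simp
  also have "\<dots> \<le> (\<Sum>y\<in>T. k)"
    using assms(4) by (rule sum_mono)
  finally show ?thesis by simp
qed

text \<open>
  Read subsets of \<open>A\<close> as vectors over the field with two elements: this is the inequality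
  \<open>dim U + dim V \<le> dim (U + V) + dim (U \<inter> V)\<close> with \<open>dim (U + V) \<le> card A\<close>, in the form of a count.
  A fibre of the addition map on \<open>U \<times> V\<close> is a translate of a copy of \<open>U \<inter> V\<close>.
\<close>

lemma card_mult_le_card_Int_symmetric_difference:
  assumes A: "finite A" and U: "U \<subseteq> Pow A" and V: "V \<subseteq> Pow A"
    and U_diff: "\<And>X Y. X \<in> U \<Longrightarrow> Y \<in> U \<Longrightarrow> sym_diff X Y \<in> U"
    and V_diff: "\<And>X Y. X \<in> V \<Longrightarrow> Y \<in> V \<Longrightarrow> sym_diff X Y \<in> V"
  shows "card U * card V \<le> 2 ^ card A * card (U \<inter> V)"
proof -
  let ?f = "\<lambda>(X, Y). sym_diff X Y"
  have fin: "finite U" "finite V" using U V A by (auto intro: finite_subset)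
  have "card {z \<in> U \<times> V. ?f z = W} \<le> card (U \<inter> V)" for W
  proof (cases "{z \<in> U \<times> V. ?f z = W} = {}")
    case True
    show ?thesis unfolding True by simp
  next
    case False
    then obtain X0 Y0 where 0: "X0 \<in> U" "Y0 \<in> V" "sym_diff X0 Y0 = W" by auto
    show ?thesis
    proof (rule card_inj_on_le[where f = "\<lambda>(X, Y). sym_diff X X0"])
      show "inj_on (\<lambda>(X, Y). sym_diff X X0) {z \<in> U \<times> V. ?f z = W}"
      proof (rule inj_onI, clarsimp)
        fix X Y X' Y'
        assume "sym_diff X' Y' = sym_diff X Y" "sym_diff X X0 = sym_diff X' X0"
        then show "X = X' \<and> Y = Y'" by blast
      qed
      show "(\<lambda>(X, Y). sym_diff X X0) ` {z \<in> U \<times> V. ?f z = W} \<subseteq> U \<inter> V"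
      proof clarify
        fix X Y assume X: "X \<in> U" and Y: "Y \<in> V" and W: "W = sym_diff X Y"
        have "sym_diff X X0 = sym_diff Y Y0" using 0(3) W by blast
        then show "sym_diff X X0 \<in> U \<inter> V"
          using U_diff[OF X 0(1)] V_diff[OF Y 0(2)] by simp
      qed
      show "finite (U \<inter> V)" using fin by simp
    qed
  qed
  moreover have "?f ` (U \<times> V) \<subseteq> Pow A"
  proof -
    have "sym_diff X Y \<subseteq> A" if "X \<in> U" "Y \<in> V" for X Y
      using that U V by blast
    then show ?thesis by fast
  qed
  ultimately have "card (U \<times> V) \<le> card (Pow A) * card (U \<inter> V)"
    using A fin by (intro card_le_card_mult_fibres) auto
  then show ?thesis using A by (simp add: card_cartesian_product card_Pow)
qed

lemma sym_diff_invariant_sets: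
  assumes "\<sigma> permutes A" "X \<in> invariant_sets A \<sigma>" "Y \<in> invariant_sets A \<sigma>"
  shows "sym_diff X Y \<in> invariant_sets A \<sigma>"
proof -
  have X: "X \<subseteq> A" "\<sigma> ` X = X" and Y: "Y \<subseteq> A" "\<sigma> ` Y = Y"
    using assms(2,3) by (simp_all add: invariant_sets_def)
  have "\<sigma> ` sym_diff X Y = sym_diff (\<sigma> ` X) (\<sigma> ` Y)"
    unfolding image_Un image_set_diff[OF permutes_inj[OF assms(1)]] ..
  then have "\<sigma> ` sym_diff X Y = sym_diff X Y"
    unfolding X Y .
  moreover have "sym_diff X Y \<subseteq> A"
    using X(1) Y(1) by blast
  ultimately show ?thesis
    by (simp only: invariant_sets_def mem_Collect_eq)
qed

text \<open>
  A set invariant under both \<open>\<sigma>\<close> and \<open>\<tau>\<close> is invariant under their product; the dimension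
  inequality above converts this inclusion into the triangle inequality for \<^const>\<open>perm_length\<close>.
\<close>

lemma card_orbits_compose_ge:
  assumes A: "finite A" and \<sigma>: "\<sigma> permutes A" and \<tau>: "\<tau> permutes A"
  shows "card (orbit \<sigma> ` A) + card (orbit \<tau> ` A) \<le> card A + card (orbit (\<sigma> \<circ> \<tau>) ` A)"
proof -
  let ?I = "invariant_sets A"
  have "?I \<sigma> \<inter> ?I \<tau> \<subseteq> ?I (\<sigma> \<circ> \<tau>)"
  proof
    fix S assume "S \<in> ?I \<sigma> \<inter> ?I \<tau>"
    then have "S \<subseteq> A" "\<sigma> ` S = S" "\<tau> ` S = S" by (auto simp: invariant_sets_def)
    then show "S \<in> ?I (\<sigma> \<circ> \<tau>)"
      unfolding invariant_sets_def image_comp[symmetric] by simp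
  qed
  then have "card (?I \<sigma> \<inter> ?I \<tau>) \<le> card (?I (\<sigma> \<circ> \<tau>))"
    using A by (intro card_mono finite_invariant_sets)
  moreover have "card (?I \<sigma>) * card (?I \<tau>) \<le> 2 ^ card A * card (?I \<sigma> \<inter> ?I \<tau>)"
    by (rule card_mult_le_card_Int_symmetric_difference[OF A _ _ sym_diff_invariant_sets[OF \<sigma>]
          sym_diff_invariant_sets[OF \<tau>]]) (simp_all add: invariant_sets_def subset_eq)
  ultimately have "card (?I \<sigma>) * card (?I \<tau>) \<le> 2 ^ card A * card (?I (\<sigma> \<circ> \<tau>))"
    by (meson mult_le_mono2 order_trans)
  then have "(2::nat) ^ (card (orbit \<sigma> ` A) + card (orbit \<tau> ` A))
      \<le> 2 ^ (card A + card (orbit (\<sigma> \<circ> \<tau>) ` A))"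
    using card_invariant_sets[OF A \<sigma>] card_invariant_sets[OF A \<tau>]
      card_invariant_sets[OF A permutes_compose[OF \<tau> \<sigma>]] by (simp add: power_add)
  then show ?thesis by (simp add: power_increasing_iff)
qed

lemma card_orbits_le: "finite A \<Longrightarrow> card (orbit \<sigma> ` A) \<le> card A"
  by (rule card_image_le)

lemma card_orbits_inv:
  assumes "finite A" "\<sigma> permutes A"
  shows "card (orbit (inv \<sigma>) ` A) = card (orbit \<sigma> ` A)"
  using card_invariant_sets[OF assms] card_invariant_sets[OF assms(1) permutes_inv[OF assms(2)]]
    invariant_sets_inv[OF assms(2)] by simp

text \<open>
  Splitting \<open>x\<close> off its cycle keeps all invariant sets, since each contains both or neither of \<open>x\<close>
  and \<open>\<sigma> x\<close>, and it creates the new invariant set \<open>{x}\<close>.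
\<close>

lemma card_orbits_transpose_gt:
  assumes A: "finite A" and \<sigma>: "\<sigma> permutes A" and x: "\<sigma> x \<noteq> x"
  shows "card (orbit \<sigma> ` A) < card (orbit (transpose x (\<sigma> x) \<circ> \<sigma>) ` A)"
proof -
  let ?\<sigma>' = "transpose x (\<sigma> x) \<circ> \<sigma>"
  have xA: "x \<in> A" "\<sigma> x \<in> A" using x \<sigma> by (metis permutes_not_in, metis permutes_in_image permutes_not_in)
  have \<sigma>': "?\<sigma>' permutes A"
    using permutes_compose[OF \<sigma> permutes_swap_id[OF xA]] .
  have "invariant_sets A \<sigma> \<subseteq> invariant_sets A ?\<sigma>'"
  proof
    fix S assume "S \<in> invariant_sets A \<sigma>"
    then have S: "S \<subseteq> A" "\<sigma> ` S = S" by (auto simp: invariant_sets_def)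
    have "x \<in> S \<longleftrightarrow> \<sigma> x \<in> S"
      using S(2) permutes_inj[OF \<sigma>] by (metis inj_image_mem_iff)
    then have "transpose x (\<sigma> x) ` S = S"
      by (rule transpose_image_eq)
    then show "S \<in> invariant_sets A ?\<sigma>'"
      using S unfolding invariant_sets_def image_comp[symmetric] by simp
  qed
  moreover have "{x} \<in> invariant_sets A ?\<sigma>'" "{x} \<notin> invariant_sets A \<sigma>"
    using x xA by (auto simp: invariant_sets_def)
  ultimately have "card (invariant_sets A \<sigma>) < card (invariant_sets A ?\<sigma>')"
    using A by (intro psubset_card_mono finite_invariant_sets) auto
  then show ?thesis
    using card_invariant_sets[OF A \<sigma>] card_invariant_sets[OF A \<sigma>'] by simp
qed

lemma perm_length_id [simp]: "perm_length p id = 0"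
proof -
  have "orbit id ` {1..p} = (\<lambda>x. {x}) ` {1..p}"
    by (rule image_cong) (auto simp: orbit_eq_singleton_iff)
  then show ?thesis by (simp add: perm_length_def card_image)
qed

lemma perm_length_compose:
  assumes "\<sigma> permutes {1..p}" "\<tau> permutes {1..p}"
  shows "perm_length p (\<sigma> \<circ> \<tau>) \<le> perm_length p \<sigma> + perm_length p \<tau>"
  using card_orbits_compose_ge[OF _ assms] by (simp add: perm_length_def)

lemma perm_length_inv:
  assumes "\<sigma> permutes {1..p}"
  shows "perm_length p (inv \<sigma>) = perm_length p \<sigma>"
  using card_orbits_inv[OF _ assms] by (simp add: perm_length_def)

lemma perm_length_reduce:
  assumes "\<sigma> permutes {1..p}" "\<sigma> \<noteq> id"
  obtains x y \<rho> where "x \<in> {1..p}" "y \<in> {1..p}" "\<rho> permutes {1..p}" "\<sigma> = transpose x y \<circ> \<rho>"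
    "perm_length p \<rho> < perm_length p \<sigma>"
proof -
  obtain x where x: "\<sigma> x \<noteq> x" using assms(2) by (auto simp: fun_eq_iff)
  have xA: "x \<in> {1..p}" "\<sigma> x \<in> {1..p}"
    using x assms(1) by (metis permutes_not_in, metis permutes_in_image permutes_not_in)
  let ?\<rho> = "transpose x (\<sigma> x) \<circ> \<sigma>"
  have \<rho>: "?\<rho> permutes {1..p}"
    using permutes_compose[OF assms(1) permutes_swap_id[OF xA]] .
  have "perm_length p ?\<rho> < perm_length p \<sigma>"
    using card_orbits_transpose_gt[OF _ assms(1) x] card_orbits_le[of "{1..p}" ?\<rho>]
    by (simp add: perm_length_def)
  moreover have "\<sigma> = transpose x (\<sigma> x) \<circ> ?\<rho>"
    by (simp add: fun_eq_iff)
  ultimately show ?thesis using that xA \<rho> by blast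
qed

lemma finite_perms: "finite {\<sigma>. \<sigma> permutes {1..p::nat}}"
  by (rule finite_permutations) simp

text \<open>
  A permutation of length at most \<open>k\<close> is a product of \<open>k\<close> factors, each of the form
  \<^term>\<open>transpose x y\<close> with possibly \<open>x = y\<close>, and there are \<open>p\<^sup>2\<close> pairs of letters per factor.
\<close>

lemma card_perm_length_ball:
  assumes "p \<ge> 1"
  shows "card {\<sigma>. \<sigma> permutes {1..p} \<and> perm_length p \<sigma> \<le> k} \<le> p ^ (2 * k)"
proof (induction k)
  case 0
  have "{\<sigma>. \<sigma> permutes {1..p} \<and> perm_length p \<sigma> \<le> 0} \<subseteq> {id}"
    using perm_length_reduce by fastforce
  then show ?case using card_mono[of "{id :: nat \<Rightarrow> nat}"] by fastforce
next
  case (Suc k)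
  let ?B = "\<lambda>k. {\<sigma>. \<sigma> permutes {1..p} \<and> perm_length p \<sigma> \<le> k}"
  let ?X = "({1..p} \<times> {1..p}) \<times> ?B k"
  have fin: "finite (?B k)" by (rule finite_subset[OF _ finite_perms]) auto
  have "?B (Suc k) \<subseteq> (\<lambda>((x, y), \<rho>). transpose x y \<circ> \<rho>) ` ?X"
  proof
    fix \<sigma> assume \<sigma>: "\<sigma> \<in> ?B (Suc k)"
    show "\<sigma> \<in> (\<lambda>((x, y), \<rho>). transpose x y \<circ> \<rho>) ` ?X"
    proof (cases "\<sigma> = id")
      case True
      \<comment> \<open>\<open>transpose 1 1\<close> is the identity, so the padding factor is available as \<open>p \<ge> 1\<close>.\<close>
      have "((1, 1), id) \<in> ?X" using assms by (auto intro: permutes_id)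
      moreover have "\<sigma> = (\<lambda>((x, y), \<rho>). transpose x y \<circ> \<rho>) ((1, 1), id)" using True by simp
      ultimately show ?thesis by blast
    next
      case False
      then obtain x y \<rho> where "x \<in> {1..p}" "y \<in> {1..p}" "\<rho> permutes {1..p}"
        "\<sigma> = transpose x y \<circ> \<rho>" "perm_length p \<rho> < perm_length p \<sigma>"
        using \<sigma> perm_length_reduce by blast
      then have "((x, y), \<rho>) \<in> ?X" using \<sigma> by auto
      then show ?thesis using \<open>\<sigma> = _\<close> by force
    qed
  qed
  then have "card (?B (Suc k)) \<le> card ?X"
    using fin by (intro surj_card_le) auto
  also have "\<dots> = p * p * card (?B k)"
    by (simp add: card_cartesian_product)
  also have "\<dots> \<le> p ^ (2 * Suc k)"
    using Suc by simp
  finally show ?case .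
qed

lemma full_cycle_permutes: "full_cycle p permutes {1..p}"
  using cycle_permutes[of "[1..<Suc p]"]
  by (simp add: full_cycle_def atLeastLessThanSuc_atLeastAtMost del: upt_Suc)

lemma perm_length_full_cycle:
  assumes "p \<ge> 1"
  shows "perm_length p (full_cycle p) = p - 1"
proof -
  have succ: "full_cycle p i = Suc i" if "i \<in> {1..<p}" for i
  proof -
    have "map (full_cycle p) [1..<Suc p] = rotate1 [1..<Suc p]"
      using cyclic_rotation[of "[1..<Suc p]" 1] by (simp add: full_cycle_def del: upt_Suc)
    then have "map (full_cycle p) [1..<Suc p] ! (i - 1) = rotate1 [1..<Suc p] ! (i - 1)" by simp
    then show ?thesis using that nth_rotate1[of "i - 1" "[1..<Suc p]"]
      by (auto simp: nth_map simp del: upt_Suc)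
  qed
  have orb: "orbit (full_cycle p) i = {1..p}" if "i \<in> {1..p}" for i
  proof -
    have "j \<in> orbit (full_cycle p) 1" if "1 \<le> j" "j \<le> p" for j
      using that
    proof (induction j rule: dec_induct)
      case base
      show ?case
        using full_cycle_permutes by (metis finite_atLeastAtMost permutation_permutes permutation_self_in_orbit)
    next
      case (step n)
      then have "n \<in> orbit (full_cycle p) 1" "full_cycle p n = Suc n"
        using succ[of n] by auto
      then show ?case using orbit.step[of n "full_cycle p" 1] by simp
    qed
    then have "orbit (full_cycle p) 1 = {1..p}"
      using permutes_orbit_subset[OF full_cycle_permutes, of 1 p] assms by auto
    then have "cyclic_on (full_cycle p) {1..p}"
      using cyclic_on_orbit[OF full_cycle_permutes, of p 1] by simp
    then show ?thesis
      using that by (rule orbit_cyclic_eq3)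
  qed
  have "orbit (full_cycle p) ` {1..p} = (\<lambda>_. {1..p}) ` {1..p}"
    by (rule image_cong[OF refl orb])
  then have "orbit (full_cycle p) ` {1..p} = {{1..p}}"
    using assms by (simp add: image_constant_conv)
  then show ?thesis by (simp add: perm_length_def)
qed

lemma perm_dist_self [simp]:
  assumes "\<sigma> permutes {1..p}" shows "perm_dist p \<sigma> \<sigma> = 0"
  using permutes_inv_o(2)[OF assms] by (simp add: perm_dist_def)

lemma perm_dist_commute:
  assumes "\<sigma> permutes {1..p}" "\<tau> permutes {1..p}"
  shows "perm_dist p \<sigma> \<tau> = perm_dist p \<tau> \<sigma>"
proof -
  have "inv (inv \<sigma> \<circ> \<tau>) = inv \<tau> \<circ> \<sigma>"
    using o_inv_distrib[OF permutes_bij[OF permutes_inv[OF assms(1)]] permutes_bij[OF assms(2)]]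
      permutes_inv_inv[OF assms(1)] by simp
  then show ?thesis
    using perm_length_inv[OF permutes_compose[OF assms(2) permutes_inv[OF assms(1)]]]
    by (simp add: perm_dist_def)
qed

lemma perm_dist_triangle:
  assumes "\<rho> permutes {1..p}" "\<sigma> permutes {1..p}" "\<tau> permutes {1..p}"
  shows "perm_dist p \<rho> \<tau> \<le> perm_dist p \<rho> \<sigma> + perm_dist p \<sigma> \<tau>"
proof -
  have "inv \<rho> \<circ> \<tau> = (inv \<rho> \<circ> \<sigma>) \<circ> (inv \<sigma> \<circ> \<tau>)"
    using permutes_inverses(1)[OF assms(2)] by (simp add: fun_eq_iff)
  then show ?thesis unfolding perm_dist_def
    using perm_length_compose[OF permutes_compose[OF assms(2) permutes_inv[OF assms(1)]]
        permutes_compose[OF assms(3) permutes_inv[OF assms(2)]]] by simp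
qed

lemma perm_dist_id_full_cycle: "p \<ge> 1 \<Longrightarrow> perm_dist p id (full_cycle p) = p - 1"
  by (simp add: perm_dist_def perm_length_full_cycle)

lemma card_perm_dist_ball:
  assumes "p \<ge> 1" "\<tau> permutes {1..p}"
  shows "card {\<sigma>. \<sigma> permutes {1..p} \<and> perm_dist p \<tau> \<sigma> \<le> k} \<le> p ^ (2 * k)"
proof -
  let ?B = "{\<sigma>. \<sigma> permutes {1..p} \<and> perm_length p \<sigma> \<le> k}"
  have "card {\<sigma>. \<sigma> permutes {1..p} \<and> perm_dist p \<tau> \<sigma> \<le> k} \<le> card ?B"
  proof (rule card_inj_on_le[where f = "\<lambda>\<sigma>. inv \<tau> \<circ> \<sigma>"])
    show "inj_on (\<lambda>\<sigma>. inv \<tau> \<circ> \<sigma>) {\<sigma>. \<sigma> permutes {1..p} \<and> perm_dist p \<tau> \<sigma> \<le> k}"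
    proof (rule inj_onI)
      fix \<sigma> \<sigma>' assume "inv \<tau> \<circ> \<sigma> = inv \<tau> \<circ> \<sigma>'"
      then have "inv \<tau> (\<sigma> x) = inv \<tau> (\<sigma>' x)" for x by (metis comp_apply)
      then have "\<sigma> x = \<sigma>' x" for x
        using permutes_inverses(1)[OF assms(2)] by metis
      then show "\<sigma> = \<sigma>'" by (rule ext)
    qed
    show "(\<lambda>\<sigma>. inv \<tau> \<circ> \<sigma>) ` {\<sigma>. \<sigma> permutes {1..p} \<and> perm_dist p \<tau> \<sigma> \<le> k} \<subseteq> ?B"
      using assms(2) by (auto simp: perm_dist_def intro: permutes_compose permutes_inv)
    show "finite ?B" by (rule finite_subset[OF _ finite_perms]) auto
  qed
  then show ?thesis using card_perm_length_ball[OF assms(1)] le_trans by blast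
qed

section \<open>Walks and cuts in undirected multigraphs\<close>

lemma bidirected_simps [simp]:
  "verts (bidirected G) = verts G"
  "arcs (bidirected G) = arcs G \<times> UNIV"
  "tail (bidirected G) (e, True) = tail G e"
  "tail (bidirected G) (e, False) = head G e"
  "head (bidirected G) (e, True) = head G e"
  "head (bidirected G) (e, False) = tail G e"
  by (simp_all add: bidirected_def)

lemma (in wf_digraph) wf_digraph_bidirected: "wf_digraph (bidirected G)"
proof
  fix x assume "x \<in> arcs (bidirected G)"
  then show "tail (bidirected G) x \<in> verts (bidirected G)" "head (bidirected G) x \<in> verts (bidirected G)"
    by (cases x; cases "snd x"; auto)+
qed

lemma (in fin_digraph) fin_digraph_bidirected: "fin_digraph (bidirected G)"
proof -
  interpret bd: wf_digraph "bidirected G" by (rule wf_digraph_bidirected)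
  show ?thesis by unfold_locales simp_all
qed

text \<open>
  Take for \<open>S\<close> the vertices that are still reachable from \<open>b\<close> after the removal of a minimum cut:
  an edge leaving \<open>S\<close> must have been removed.
\<close>

lemma (in fin_digraph) min_cut_boundary:
  assumes "b \<in> verts G" "b \<noteq> a"
  obtains S where "b \<in> S" "a \<notin> S" "card {e \<in> arcs G. (tail G e \<in> S) \<noteq> (head G e \<in> S)} \<le> min_cut G b a"
proof -
  have "\<not> reachable (bidirected (G\<lparr>arcs := arcs G - arcs G\<rparr>)) b a"
  proof
    let ?H = "G\<lparr>arcs := {}\<rparr>"
    interpret H: wf_digraph ?H by unfold_locales auto
    interpret bd: wf_digraph "bidirected ?H" by (rule H.wf_digraph_bidirected)
    assume "reachable (bidirected (G\<lparr>arcs := arcs G - arcs G\<rparr>)) b a"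
    then have "reachable (bidirected ?H) b a" unfolding Diff_cancel .
    then obtain w where "bd.awalk b w a" using bd.reachable_awalk by blast
    then have w: "set w \<subseteq> arcs (bidirected ?H)" "bd.cas b w a" unfolding bd.awalk_def by blast+
    then have "w = []" by simp
    with w(2) have "bd.cas b [] a" by blast
    then show False using assms(2) by (simp only: bd.cas.simps)
  qed
  then have "separating_cut G b a (arcs G)" by (simp add: separating_cut_def)
  then have "\<exists>C. separating_cut G b a C \<and> card C = min_cut G b a"
    unfolding min_cut_def by (intro LeastI) blast
  then obtain C where C: "separating_cut G b a C" "card C = min_cut G b a" by blast
  let ?H = "G\<lparr>arcs := arcs G - C\<rparr>"
  interpret H: wf_digraph ?H by unfold_locales auto
  interpret bd: wf_digraph "bidirected ?H" by (rule H.wf_digraph_bidirected)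
  define S where "S = {u. reachable (bidirected ?H) b u}"
  have closed: "head (bidirected ?H) x \<in> S" if "x \<in> arcs (bidirected ?H)" "tail (bidirected ?H) x \<in> S" for x
    using bd.reachable_trans[OF _ bd.reachable_awalkI[OF bd.arc_implies_awalk[OF that(1)]]] that(2)
    unfolding S_def by blast
  have "{e \<in> arcs G. (tail G e \<in> S) \<noteq> (head G e \<in> S)} \<subseteq> C"
  proof clarify
    fix e assume e: "e \<in> arcs G" "(tail G e \<in> S) \<noteq> (head G e \<in> S)"
    show "e \<in> C"
    proof (rule ccontr)
      assume "e \<notin> C"
      then have "(e, True) \<in> arcs (bidirected ?H)" "(e, False) \<in> arcs (bidirected ?H)"
        using e(1) by simp_all
      from this[THEN closed] show False using e(2) by auto
    qed
  qed
  moreover have "finite C"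
    using C(1) finite_subset[OF _ finite_arcs] unfolding separating_cut_def by blast
  ultimately have "card {e \<in> arcs G. (tail G e \<in> S) \<noteq> (head G e \<in> S)} \<le> min_cut G b a"
    unfolding C(2)[symmetric] by (intro card_mono)
  moreover have "b \<in> S" using assms(1) by (simp add: S_def)
  moreover have "a \<notin> S" using C(1) by (simp add: S_def separating_cut_def)
  ultimately show ?thesis using that by blast
qed

lemma (in pre_digraph) sum_list_telescope_cas:
  fixes f :: "'a \<Rightarrow> int"
  assumes "cas u w v"
  shows "(\<Sum>x\<leftarrow>w. f (head G x) - f (tail G x)) = f v - f u"
  using assms by (induction w arbitrary: u) auto

text \<open>
  A path that returned along an edge would return to an endpoint that it has already visited.
\<close>

lemma (in wf_digraph) distinct_edges_apath_bidirected:
  assumes "pre_digraph.apath (bidirected G) u w v"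
  shows "distinct (map fst w)"
proof -
  interpret bd: wf_digraph "bidirected G" by (rule wf_digraph_bidirected)
  show ?thesis
    using assms
  proof (induction w arbitrary: u)
    case (Cons x w)
    let ?u' = "head (bidirected G) x"
    from Cons.prems have w: "bd.apath ?u' w v" "tail (bidirected G) x \<notin> set (bd.awalk_verts ?u' w)"
      by (auto simp: bd.apath_Cons_iff)
    have "fst y \<noteq> fst x" if "y \<in> set w" for y
    proof
      assume "fst y = fst x"
      then have "tail (bidirected G) x \<in> {tail (bidirected G) y, head (bidirected G) y}"
        by (cases x; cases y; cases "snd x"; cases "snd y") auto
      moreover have "tail (bidirected G) y \<in> set (bd.awalk_verts ?u' w)"
        "head (bidirected G) y \<in> set (bd.awalk_verts ?u' w)"
        using bd.awalk_verts_arc1[OF that] bd.awalk_verts_arc2[OF bd.awalkI_apath[OF w(1)] that]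
        by blast+
      ultimately show False using w(2) by auto
    qed
    then have "fst x \<notin> fst ` set w" by fastforce
    then show ?case using Cons.IH[OF w(1)] by simp
  qed simp
qed

section \<open>Defects and coefficients\<close>

lemma (in fin_digraph) finite_labelings: "finite (labelings G b a p)"
proof -
  have "finite (verts G \<rightarrow>\<^sub>E {\<sigma>. \<sigma> permutes {1..p}})"
    by (intro finite_PiE finite_verts finite_perms)
  then show ?thesis unfolding labelings_def by (rule rev_finite_subset) blast
qed

lemma labelings_permutes:
  assumes "\<pi> \<in> labelings G b a p" "u \<in> verts G"
  shows "\<pi> u permutes {1..p}"
  using assms by (auto simp: labelings_def PiE_iff)

lemma (in fin_digraph) summable_moment_poly:
  "summable (\<lambda>\<delta>. real (defect_count G b a s p \<delta>) / real N ^ \<delta>)"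
proof (rule summable_finite)
  let ?D = "(\<lambda>\<pi>. nat (label_defect G s p \<pi>)) ` labelings G b a p"
  show "finite ?D" using finite_labelings by simp
  show "real (defect_count G b a s p \<delta>) / real N ^ \<delta> = 0" if "\<delta> \<notin> ?D" for \<delta>
  proof -
    have none: "{\<pi> \<in> labelings G b a p. label_defect G s p \<pi> = int \<delta>} = {}"
      using that by force
    show ?thesis unfolding defect_count_def none by simp
  qed
qed

text \<open>
  A labeling of defect \<open>\<epsilon> \<le> k\<close> contributes \<open>M ^ (k - \<epsilon>) \<ge> 1\<close> to the right-hand side. Nonnegative
  defects matter here, because the series sees no others.
\<close>

lemma (in fin_digraph) card_label_defect_le_moment_poly:
  assumes M: "M \<ge> 1"
    and nonneg: "\<And>\<tau>. \<tau> \<in> labelings G b a p \<Longrightarrow> 0 \<le> label_defect G s p \<tau>"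
  shows "real (card {\<tau> \<in> labelings G b a p. label_defect G s p \<tau> \<le> int k})
    \<le> real M ^ k * moment_poly G b a s p M"
proof -
  let ?c = "defect_count G b a s p"
  let ?T = "{\<tau> \<in> labelings G b a p. label_defect G s p \<tau> \<le> int k}"
  have fin: "finite ?T" using finite_labelings by simp
  have "(\<lambda>\<tau>. nat (label_defect G s p \<tau>)) ` ?T \<subseteq> {..k}" by auto
  from sum.group[OF fin _ this, of "\<lambda>_. 1 :: nat"]
  have "card ?T = (\<Sum>\<epsilon>\<le>k. card {\<tau> \<in> ?T. nat (label_defect G s p \<tau>) = \<epsilon>})" by simp
  also have "\<dots> = (\<Sum>\<epsilon>\<le>k. ?c \<epsilon>)"
  proof (rule sum.cong[OF refl])
    fix \<epsilon> assume "\<epsilon> \<in> {..k}"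
    then have "{\<tau> \<in> ?T. nat (label_defect G s p \<tau>) = \<epsilon>}
        = {\<tau> \<in> labelings G b a p. label_defect G s p \<tau> = int \<epsilon>}"
      using nonneg by auto
    then show "card {\<tau> \<in> ?T. nat (label_defect G s p \<tau>) = \<epsilon>} = ?c \<epsilon>"
      unfolding defect_count_def by simp
  qed
  finally have "real (card ?T) = (\<Sum>\<epsilon>\<le>k. real (?c \<epsilon>))" by simp
  also have "\<dots> \<le> (\<Sum>\<epsilon>\<le>k. real M ^ k * (real (?c \<epsilon>) / real M ^ \<epsilon>))"
  proof (rule sum_mono)
    fix \<epsilon> assume "\<epsilon> \<in> {..k}"
    then have "real M ^ \<epsilon> \<le> real M ^ k"
      using M by (intro power_increasing) auto
    then have "real (?c \<epsilon>) * real M ^ \<epsilon> \<le> real (?c \<epsilon>) * real M ^ k"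
      by (rule mult_left_mono) simp
    then show "real (?c \<epsilon>) \<le> real M ^ k * (real (?c \<epsilon>) / real M ^ \<epsilon>)"
      using M by (simp add: pos_le_divide_eq mult.commute)
  qed
  also have "\<dots> = real M ^ k * (\<Sum>\<epsilon>\<le>k. real (?c \<epsilon>) / real M ^ \<epsilon>)"
    by (simp add: sum_distrib_left)
  also have "\<dots> \<le> real M ^ k * moment_poly G b a s p M"
    unfolding moment_poly_def
    by (intro mult_left_mono sum_le_suminf summable_moment_poly) simp_all
  finally show ?thesis .
qed

section \<open>The excess of a labeling along the flow\<close>

locale maximum_flow = fin_digraph G for G :: "('v, 'e) pre_digraph" +
  fixes b a :: 'v and P :: "('e \<times> bool) list set"
  assumes b_verts: "b \<in> verts G" and a_verts: "a \<in> verts G" and terminals_neq: "b \<noteq> a"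
    and disjoint_paths: "edge_disjoint_paths G b a P"
    and card_paths: "card P = min_cut G b a"
begin

abbreviation s where "s \<equiv> min_cut G b a"
abbreviation F where "F \<equiv> flow_digraph G P"
abbreviation Q where "Q \<equiv> flow_quotient G P"
abbreviation component where "component \<equiv> flow_component G P"
abbreviation used where "used \<equiv> \<Union>w\<in>P. set w"
abbreviation unused where "unused \<equiv> arcs G - fst ` used"

sublocale bd: fin_digraph "bidirected G" by (rule fin_digraph_bidirected)

lemma apath_of_P: "w \<in> P \<Longrightarrow> bd.apath b w a"
  using disjoint_paths by (simp add: edge_disjoint_paths_def)

lemma disjoint_of_P:
  "w \<in> P \<Longrightarrow> w' \<in> P \<Longrightarrow> w \<noteq> w' \<Longrightarrow> fst ` set w \<inter> fst ` set w' = {}"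
  using disjoint_paths by (simp add: edge_disjoint_paths_def pairwise_def disjnt_def)

lemma finite_P: "finite P"
  by (rule finite_subset[OF _ bd.apaths_finite[of b a]]) (auto dest: apath_of_P)

lemma used_subset: "used \<subseteq> arcs (bidirected G)"
  using apath_of_P unfolding bd.apath_def bd.awalk_def by blast

lemma flow_digraph_simps [simp]:
  "verts F = verts G"
  "arcs F = used \<union> unused \<times> UNIV"
  "tail F = tail (bidirected G)"
  "head F = head (bidirected G)"
  by (simp_all add: flow_digraph_def Let_def)

lemma arcs_F_subset: "arcs F \<subseteq> arcs (bidirected G)"
  using used_subset by auto

sublocale F: fin_digraph F
proof
  show "tail F x \<in> verts F" "head F x \<in> verts F" if "x \<in> arcs F" for x
    using bd.tail_in_verts[OF subsetD[OF arcs_F_subset that]]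
      bd.head_in_verts[OF subsetD[OF arcs_F_subset that]] by simp_all
  show "finite (verts F)" "finite (arcs F)"
    using finite_subset[OF arcs_F_subset bd.finite_arcs] by simp_all
qed

lemma inj_on_fst_used: "inj_on fst used"
proof (rule inj_onI)
  fix x y assume xy: "x \<in> used" "y \<in> used" "fst x = fst y"
  then obtain w w' where w: "w \<in> P" "x \<in> set w" "w' \<in> P" "y \<in> set w'" by blast
  then have "w = w'" using disjoint_of_P[of w w'] xy(3) by force
  moreover have "inj_on fst (set w)"
    using distinct_edges_apath_bidirected[OF apath_of_P[OF w(1)]] by (simp add: distinct_map)
  ultimately show "x = y" using inj_onD[of fst "set w" x y] w(2,4) xy(3) by simp
qed

definition arc_dist :: "nat \<Rightarrow> ('v \<Rightarrow> nat \<Rightarrow> nat) \<Rightarrow> 'e \<times> bool \<Rightarrow> int" where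
  "arc_dist p \<pi> x = int (perm_dist p (\<pi> (tail (bidirected G) x)) (\<pi> (head (bidirected G) x)))"

text \<open>
  The height serves as a potential: a directed cycle of the flow digraph has no total gain, so its
  length equals its excess.
\<close>

definition height :: "nat \<Rightarrow> ('v \<Rightarrow> nat \<Rightarrow> nat) \<Rightarrow> 'v \<Rightarrow> int" where
  "height p \<pi> u = int (perm_dist p id (\<pi> u))"

definition excess :: "nat \<Rightarrow> ('v \<Rightarrow> nat \<Rightarrow> nat) \<Rightarrow> 'e \<times> bool \<Rightarrow> int" where
  "excess p \<pi> x = arc_dist p \<pi> x
     - (height p \<pi> (head (bidirected G) x) - height p \<pi> (tail (bidirected G) x))"

context
  fixes p :: nat and \<pi> :: "'v \<Rightarrow> nat \<Rightarrow> nat"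
  assumes p: "p \<ge> 1" and \<pi>: "\<pi> \<in> labelings G b a p"
begin

lemma height_b: "height p \<pi> b = 0" and height_a: "height p \<pi> a = int p - 1"
proof -
  have "\<pi> b = id" "\<pi> a = full_cycle p" using \<pi> by (simp_all add: labelings_def)
  then show "height p \<pi> b = 0" "height p \<pi> a = int p - 1"
    using perm_dist_self[OF permutes_id, of p] perm_dist_id_full_cycle[OF p] p
    by (simp_all add: height_def of_nat_diff)
qed

lemma excess_nonneg:
  assumes "x \<in> arcs (bidirected G)"
  shows "0 \<le> excess p \<pi> x"
proof -
  have "tail (bidirected G) x \<in> verts G" "head (bidirected G) x \<in> verts G"
    using bd.tail_in_verts[OF assms] bd.head_in_verts[OF assms] by simp_all
  then show ?thesis
    using perm_dist_triangle[OF permutes_id labelings_permutes[OF \<pi>] labelings_permutes[OF \<pi>],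
        of "tail (bidirected G) x" "head (bidirected G) x"]
    unfolding excess_def arc_dist_def height_def by linarith
qed

lemma arc_dist_reverse:
  assumes "e \<in> arcs G"
  shows "arc_dist p \<pi> (e, False) = arc_dist p \<pi> (e, True)"
  using perm_dist_commute[OF labelings_permutes[OF \<pi>] labelings_permutes[OF \<pi>],
      OF head_in_verts[OF assms] tail_in_verts[OF assms]]
  by (simp add: arc_dist_def)

lemma arc_dist_fst:
  assumes "x \<in> arcs (bidirected G)"
  shows "arc_dist p \<pi> x = arc_dist p \<pi> (fst x, True)"
  using assms arc_dist_reverse[of "fst x"] by (cases x; cases "snd x") simp_all

lemma sum_excess_path:
  assumes "bd.apath u w v"
  shows "(\<Sum>x\<in>set w. excess p \<pi> x) = (\<Sum>x\<in>set w. arc_dist p \<pi> x) - (height p \<pi> v - height p \<pi> u)"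
proof -
  have w: "distinct w" "bd.cas u w v"
    using distinct_edges_apath_bidirected[OF assms] assms
    by (simp_all add: distinct_map bd.apath_def bd.awalk_def)
  have "(\<Sum>x\<in>set w. height p \<pi> (head (bidirected G) x) - height p \<pi> (tail (bidirected G) x))
      = height p \<pi> v - height p \<pi> u"
    using bd.sum_list_telescope_cas[OF w(2), of "height p \<pi>"] w(1)
    by (simp add: sum_list_distinct_conv_sum_set)
  then show ?thesis by (simp add: excess_def sum_subtractf)
qed

lemma sum_over_used:
  fixes f :: "'e \<times> bool \<Rightarrow> int"
  shows "(\<Sum>x\<in>used. f x) = (\<Sum>w\<in>P. \<Sum>x\<in>set w. f x)"
proof (rule sum.UNION_disjoint[OF finite_P])
  show "\<forall>w\<in>P. \<forall>w'\<in>P. w \<noteq> w' \<longrightarrow> set w \<inter> set w' = {}"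
    using disjoint_of_P by blast
qed simp

text \<open>
  The gains along each of the \<open>s\<close> paths telescope from height \<open>0\<close> to height \<open>p - 1\<close>.
\<close>

lemma sum_excess_used:
  "(\<Sum>x\<in>used. excess p \<pi> x) = (\<Sum>x\<in>used. arc_dist p \<pi> x) - int s * (int p - 1)"
proof -
  have "(\<Sum>x\<in>used. excess p \<pi> x) = (\<Sum>w\<in>P. (\<Sum>x\<in>set w. arc_dist p \<pi> x) - (int p - 1))"
    unfolding sum_over_used
    by (rule sum.cong[OF refl]) (simp add: sum_excess_path[OF apath_of_P] height_a height_b)
  also have "\<dots> = (\<Sum>x\<in>used. arc_dist p \<pi> x) - int s * (int p - 1)"
    by (simp add: sum_subtractf sum_over_used card_paths)
  finally show ?thesis .
qed

lemma label_energy_split: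
  "int (label_energy G p \<pi>) = (\<Sum>x\<in>used. arc_dist p \<pi> x) + (\<Sum>e\<in>unused. arc_dist p \<pi> (e, True))"
proof -
  have "fst ` used \<subseteq> arcs G" using image_mono[OF used_subset, of fst] by simp
  then have "int (label_energy G p \<pi>)
      = (\<Sum>e\<in>fst ` used. arc_dist p \<pi> (e, True)) + (\<Sum>e\<in>unused. arc_dist p \<pi> (e, True))"
    unfolding label_energy_def of_nat_sum arc_dist_def bidirected_simps
    by (subst sum.subset_diff[OF _ finite_arcs]) (assumption, rule add.commute)
  moreover have "(\<Sum>e\<in>fst ` used. arc_dist p \<pi> (e, True)) = (\<Sum>x\<in>used. arc_dist p \<pi> x)"
    unfolding sum.reindex[OF inj_on_fst_used]
    by (rule sum.cong[OF refl]) (simp only: o_def arc_dist_fst[OF subsetD[OF used_subset]])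
  ultimately show ?thesis by simp
qed

lemma sum_dist_unused_le_defect:
  "(\<Sum>e\<in>unused. arc_dist p \<pi> (e, True)) \<le> label_defect G s p \<pi>"
proof -
  have "0 \<le> (\<Sum>x\<in>used. excess p \<pi> x)"
    by (intro sum_nonneg excess_nonneg subsetD[OF used_subset])
  then show ?thesis
    by (simp add: sum_excess_used label_defect_def label_energy_split)
qed

lemma label_defect_nonneg: "0 \<le> label_defect G s p \<pi>"
proof -
  have "0 \<le> (\<Sum>e\<in>unused. arc_dist p \<pi> (e, True))"
    by (intro sum_nonneg) (simp add: arc_dist_def)
  then show ?thesis using sum_dist_unused_le_defect by simp
qed

text \<open>
  For an unused edge both arcs belong to the flow digraph. Their gains in height are opposite, so
  their excesses add up to twice the length of the edge. The total is thus the defect plus the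
  length of the unused edges, which itself is at most the defect.
\<close>

lemma sum_excess_le: "(\<Sum>x\<in>arcs F. excess p \<pi> x) \<le> 2 * label_defect G s p \<pi>"
proof -
  have fin: "finite used" using finite_subset[OF used_subset bd.finite_arcs] .
  have "(\<Sum>x\<in>unused \<times> UNIV. excess p \<pi> x) = (\<Sum>e\<in>unused. excess p \<pi> (e, True) + excess p \<pi> (e, False))"
    using sum.cartesian_product[of "\<lambda>e d. excess p \<pi> (e, d)" UNIV unused]
    by (simp add: UNIV_bool add.commute)
  also have "\<dots> = (\<Sum>e\<in>unused. 2 * arc_dist p \<pi> (e, True))"
    by (rule sum.cong[OF refl]) (simp add: excess_def arc_dist_reverse)
  finally have "(\<Sum>x\<in>unused \<times> UNIV. excess p \<pi> x) = 2 * (\<Sum>e\<in>unused. arc_dist p \<pi> (e, True))"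
    by (simp add: sum_distrib_left)
  moreover have "(\<Sum>x\<in>arcs F. excess p \<pi> x)
      = (\<Sum>x\<in>used. excess p \<pi> x) + (\<Sum>x\<in>unused \<times> UNIV. excess p \<pi> x)"
    unfolding flow_digraph_simps 
  proof (rule sum.union_disjoint[OF fin])
    show "used \<inter> unused \<times> UNIV = {}" by force
  qed simp
  ultimately have "(\<Sum>x\<in>arcs F. excess p \<pi> x)
      = label_defect G s p \<pi> + (\<Sum>e\<in>unused. arc_dist p \<pi> (e, True))"
    unfolding sum_excess_used label_defect_def label_energy_split by linarith
  then show ?thesis
    using sum_dist_unused_le_defect by linarith
qed

lemma dist_le_sum_arc_dist:
  assumes "bd.awalk u w v"
  shows "int (perm_dist p (\<pi> u) (\<pi> v)) \<le> (\<Sum>x\<leftarrow>w. arc_dist p \<pi> x)"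
  using assms
proof (induction w arbitrary: u)
  case Nil
  then have "u = v" "v \<in> verts G" by (auto simp: bd.awalk_Nil_iff)
  then show ?case using perm_dist_self[OF labelings_permutes[OF \<pi>]] by simp
next
  case (Cons x w)
  let ?u' = "head (bidirected G) x"
  have w: "u = tail (bidirected G) x" "bd.awalk ?u' w v" "u \<in> verts G" "?u' \<in> verts G" "v \<in> verts G"
    using Cons.prems bd.awalk_hd_in_verts[OF Cons.prems] bd.awalk_last_in_verts[OF Cons.prems]
      bd.awalk_hd_in_verts[of ?u' w v]
    by (simp_all add: bd.awalk_Cons_iff)
  have "int (perm_dist p (\<pi> u) (\<pi> v)) \<le> arc_dist p \<pi> x + int (perm_dist p (\<pi> ?u') (\<pi> v))"
    using perm_dist_triangle[OF w(3,4,5)[THEN labelings_permutes[OF \<pi>]]] w(1)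
    by (simp add: arc_dist_def)
  then show ?case using Cons.IH[OF w(2)] by simp
qed

text \<open>
  A simple path meets every arc of the flow digraph at most once, so its excess is part of the total
  excess.
\<close>

lemma dist_le_height_diff:
  assumes "u \<rightarrow>\<^sup>*\<^bsub>F\<^esub> v"
  shows "int (perm_dist p (\<pi> u) (\<pi> v)) \<le> 2 * label_defect G s p \<pi> + (height p \<pi> v - height p \<pi> u)"
proof -
  obtain w where w: "F.apath u w v" using assms F.reachable_apath by blast
  then have arcs: "set w \<subseteq> arcs F" by (auto simp: F.apath_def F.awalk_def)
  have cas: "bd.cas u w v" if "F.cas u w v" for u
    using that by (induction w arbitrary: u) (auto simp: F.cas.simps bd.cas.simps)
  have vs: "F.awalk_verts u w = bd.awalk_verts u w" for u
    by (induction w arbitrary: u) (auto simp: F.awalk_verts.simps bd.awalk_verts.simps)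
  have bw: "bd.apath u w v"
    using w subset_trans[OF arcs arcs_F_subset] cas vs
    unfolding F.apath_def F.awalk_def bd.apath_def bd.awalk_def by simp
  then have "distinct w" using distinct_edges_apath_bidirected by (simp add: distinct_map)
  then have "int (perm_dist p (\<pi> u) (\<pi> v)) \<le> (\<Sum>x\<in>set w. arc_dist p \<pi> x)"
    using dist_le_sum_arc_dist[of u w v] bw
    by (simp add: bd.apath_def sum_list_distinct_conv_sum_set)
  also have "\<dots> = (\<Sum>x\<in>set w. excess p \<pi> x) + (height p \<pi> v - height p \<pi> u)"
    using sum_excess_path[OF bw] by simp
  also have "(\<Sum>x\<in>set w. excess p \<pi> x) \<le> (\<Sum>x\<in>arcs F. excess p \<pi> x)"
    using arcs arcs_F_subset by (intro sum_mono2 F.finite_arcs excess_nonneg) blast+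
  also have "\<dots> \<le> 2 * label_defect G s p \<pi>" by (rule sum_excess_le)
  finally show ?thesis by simp
qed

text \<open>
  Adding \<open>dist_le_height_diff\<close> for the two directions cancels the heights.
\<close>

lemma dist_le_twice_defect:
  assumes "v \<in> component u"
  shows "int (perm_dist p (\<pi> u) (\<pi> v)) \<le> 2 * label_defect G s p \<pi>"
proof -
  have uv: "u \<rightarrow>\<^sup>*\<^bsub>F\<^esub> v" "v \<rightarrow>\<^sup>*\<^bsub>F\<^esub> u"
    using assms by (simp_all add: flow_component_def F.scc_of_def)
  then have "u \<in> verts G" "v \<in> verts G" using F.reachable_in_verts by auto
  then show ?thesis
    using dist_le_height_diff[OF uv(1)] dist_le_height_diff[OF uv(2)]
      perm_dist_commute[OF labelings_permutes[OF \<pi>] labelings_permutes[OF \<pi>], of u v]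
    by simp
qed

end

section \<open>Comparison with the flow quotient\<close>

lemma flow_quotient_simps [simp]:
  "verts Q = F.sccs_verts"
  "arcs Q = {e \<in> arcs G. component (tail G e) \<noteq> component (head G e)}"
  "tail Q e = component (tail G e)"
  "head Q e = component (head G e)"
  by (simp_all add: flow_quotient_def)

lemma flow_component_in_verts_Q: "u \<in> verts G \<Longrightarrow> component u \<in> verts Q"
  using F.scc_of_in_sccs_verts[of u] by (simp add: flow_component_def)

lemma self_in_flow_component: "u \<in> verts G \<Longrightarrow> u \<in> component u"
  using F.in_scc_of_self[of u] by (simp add: flow_component_def)

lemma flow_component_eq:
  assumes "C \<in> verts Q" "u \<in> C"
  shows "u \<in> verts G" "component u = C"
proof -
  show "u \<in> verts G" using assms F.sccs_verts_subsets by auto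
  then have "u \<in> component u" "component u \<in> verts Q"
    using self_in_flow_component flow_component_in_verts_Q by blast+
  then show "component u = C" using assms F.sccs_verts_disjoint[of "component u" C] by auto
qed

sublocale Q: fin_digraph Q
proof
  show "tail Q e \<in> verts Q" "head Q e \<in> verts Q" if "e \<in> arcs Q" for e
    using that flow_component_in_verts_Q[OF tail_in_verts] flow_component_in_verts_Q[OF head_in_verts]
    by simp_all
  show "finite (verts Q)" using F.finite_sccs_verts by simp
  show "finite (arcs Q)" by simp
qed

text \<open>
  Pulling a labeling of the quotient back to \<open>G\<close> preserves its energy, because the edges inside
  components get length \<open>0\<close>.
\<close>

lemma label_defect_Q_nonneg:
  assumes "p \<ge> 1" and \<tau>: "\<tau> \<in> labelings Q (component b) (component a) p"
  shows "0 \<le> label_defect Q s p \<tau>"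
proof -
  define \<pi> where "\<pi> = (\<lambda>u\<in>verts G. \<tau> (component u))"
  have perm: "\<tau> (component u) permutes {1..p}" if "u \<in> verts G" for u
    using labelings_permutes[OF \<tau> flow_component_in_verts_Q[OF that]] .
  have \<pi>: "\<pi> \<in> labelings G b a p"
    using \<tau> perm b_verts a_verts by (auto simp: labelings_def \<pi>_def)
  have "label_energy G p \<pi> = (\<Sum>e\<in>arcs G. perm_dist p (\<tau> (component (tail G e))) (\<tau> (component (head G e))))"
    unfolding label_energy_def by (rule sum.cong[OF refl]) (simp add: \<pi>_def)
  also have "\<dots> = (\<Sum>e\<in>arcs Q. perm_dist p (\<tau> (component (tail G e))) (\<tau> (component (head G e))))"
  proof (rule sum.mono_neutral_right[OF finite_arcs])
    show "\<forall>e\<in>arcs G - arcs Q. perm_dist p (\<tau> (component (tail G e))) (\<tau> (component (head G e))) = 0"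
    proof
      fix e assume "e \<in> arcs G - arcs Q"
      then have "e \<in> arcs G" "component (tail G e) = component (head G e)" by auto
      then show "perm_dist p (\<tau> (component (tail G e))) (\<tau> (component (head G e))) = 0"
        using perm_dist_self[OF perm[OF head_in_verts]] by simp
    qed
  qed auto
  finally have "label_energy G p \<pi> = label_energy Q p \<tau>"
    by (simp add: label_energy_def)
  then show ?thesis
    using label_defect_nonneg[OF assms(1) \<pi>] by (simp add: label_defect_def)
qed

text \<open>
  Labeling the two sides of a minimum cut by \<open>id\<close> and by the full cycle yields defect at most
  \<open>0\<close>, since the flow has as many paths as the cut has edges. If the terminals shared a component,
  their labels would then be at distance \<open>0\<close>; on two letters their distance is \<open>1\<close>.
\<close>

lemma terminal_components_neq: "component b \<noteq> component a"
proof
  assume eq: "component b = component a"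
  obtain S where S: "b \<in> S" "a \<notin> S"
    "card {e \<in> arcs G. (tail G e \<in> S) \<noteq> (head G e \<in> S)} \<le> s"
    using min_cut_boundary[OF b_verts terminals_neq] .
  define \<pi> where "\<pi> = (\<lambda>u\<in>verts G. if u \<in> S then id else full_cycle 2)"
  have \<pi>: "\<pi> \<in> labelings G b a 2"
    using S b_verts a_verts full_cycle_permutes[of 2] permutes_id
    by (simp add: labelings_def \<pi>_def restrict_PiE_iff)
  have dist: "perm_dist 2 id (full_cycle 2) = 1"
    using perm_dist_id_full_cycle[of 2] by simp
  then have dist': "perm_dist 2 (full_cycle 2) id = 1"
    using perm_dist_commute[OF permutes_id full_cycle_permutes, of 2] by simp
  have "label_energy G 2 \<pi> = (\<Sum>e\<in>arcs G. if (tail G e \<in> S) \<noteq> (head G e \<in> S) then 1 else 0)"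
    unfolding label_energy_def
    by (rule sum.cong[OF refl])
      (simp add: \<pi>_def dist dist' perm_dist_self[OF permutes_id] perm_dist_self[OF full_cycle_permutes])
  also have "\<dots> = card {e \<in> arcs G. (tail G e \<in> S) \<noteq> (head G e \<in> S)}"
    by (simp flip: sum.inter_filter)
  finally have "label_defect G s 2 \<pi> \<le> 0"
    using S(3) by (simp add: label_defect_def)
  moreover have "a \<in> component b" using self_in_flow_component[OF a_verts] eq by simp
  then have "int (perm_dist 2 (\<pi> b) (\<pi> a)) \<le> 2 * label_defect G s 2 \<pi>"
    using dist_le_twice_defect[OF _ \<pi>, of a b] by simp
  moreover have "perm_dist 2 (\<pi> b) (\<pi> a) = 1"
    using S b_verts a_verts dist by (simp add: \<pi>_def)
  ultimately show False by simp
qed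

text \<open>
  Representing the terminal components by the terminals themselves gives the collapsed labeling
  the prescribed terminal labels.
\<close>

definition representative :: "'v set \<Rightarrow> 'v" where
  "representative C = (if C = component b then b else if C = component a then a else SOME u. u \<in> C)"

lemma representative_in:
  assumes "C \<in> verts Q"
  shows "representative C \<in> C"
proof -
  have "C \<noteq> {}" using assms by (auto simp: F.in_sccs_verts_conv_reachable)
  then show ?thesis
    using self_in_flow_component[OF b_verts] self_in_flow_component[OF a_verts]
    by (auto simp: representative_def some_in_eq)
qed

definition collapse :: "('v \<Rightarrow> nat \<Rightarrow> nat) \<Rightarrow> 'v set \<Rightarrow> nat \<Rightarrow> nat" where
  "collapse \<pi> = (\<lambda>C\<in>verts Q. \<pi> (representative C))"

lemma collapse_in_labelings:
  assumes \<pi>: "\<pi> \<in> labelings G b a p"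
  shows "collapse \<pi> \<in> labelings Q (component b) (component a) p"
proof -
  have "\<pi> (representative C) permutes {1..p}" if "C \<in> verts Q" for C
    using labelings_permutes[OF \<pi>] flow_component_eq(1)[OF that representative_in[OF that]] .
  moreover have "\<pi> (representative (component b)) = id" "\<pi> (representative (component a)) = full_cycle p"
    using \<pi> terminal_components_neq by (auto simp: representative_def labelings_def)
  ultimately show ?thesis
    using flow_component_in_verts_Q[OF b_verts] flow_component_in_verts_Q[OF a_verts]
    unfolding labelings_def collapse_def by (simp add: restrict_PiE_iff)
qed

lemma dist_collapse:
  assumes "p \<ge> 1" and \<pi>: "\<pi> \<in> labelings G b a p" and u: "u \<in> verts G"
  shows "int (perm_dist p (collapse \<pi> (component u)) (\<pi> u)) \<le> 2 * label_defect G s p \<pi>"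
proof -
  let ?r = "representative (component u)"
  have C: "component u \<in> verts Q" using flow_component_in_verts_Q[OF u] .
  have r: "?r \<in> component u" "?r \<in> verts G"
    using representative_in[OF C] flow_component_eq(1)[OF C] by blast+
  have "perm_dist p (collapse \<pi> (component u)) (\<pi> u) = perm_dist p (\<pi> u) (\<pi> ?r)"
    using C perm_dist_commute[OF labelings_permutes[OF \<pi> u] labelings_permutes[OF \<pi> r(2)]]
    unfolding collapse_def by simp
  then show ?thesis
    using dist_le_twice_defect[OF assms(1) \<pi> r(1)] by simp
qed

text \<open>
  The labels at both ends of an edge move by at most \<open>2 \<delta>\<close>, so its length grows by at most
  \<open>4 \<delta>\<close>.
\<close>

lemma label_defect_collapse:
  assumes p: "p \<ge> 1" and \<pi>: "\<pi> \<in> labelings G b a p"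
  shows "label_defect Q s p (collapse \<pi>) \<le> (1 + 4 * int (card (arcs G))) * label_defect G s p \<pi>"
proof -
  let ?\<tau> = "collapse \<pi>" and ?\<delta> = "label_defect G s p \<pi>"
  let ?d = "\<lambda>e. int (perm_dist p (\<pi> (tail G e)) (\<pi> (head G e)))"
  have step: "int (perm_dist p (?\<tau> (component (tail G e))) (?\<tau> (component (head G e)))) \<le> ?d e + 4 * ?\<delta>"
    if "e \<in> arcs G" for e
  proof -
    have perm: "\<pi> u permutes {1..p}" "?\<tau> (component u) permutes {1..p}" if "u \<in> verts G" for u
      using labelings_permutes[OF \<pi> that]
        labelings_permutes[OF collapse_in_labelings[OF \<pi>] flow_component_in_verts_Q[OF that]] .
    let ?t = "tail G e" and ?h = "head G e"
    have t: "?t \<in> verts G" and h: "?h \<in> verts G" using that by simp_all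
    have "perm_dist p (?\<tau> (component ?t)) (?\<tau> (component ?h))
        \<le> perm_dist p (?\<tau> (component ?t)) (\<pi> ?t) + perm_dist p (\<pi> ?t) (?\<tau> (component ?h))"
      using perm_dist_triangle perm[OF t] perm[OF h] by blast
    moreover have "perm_dist p (\<pi> ?t) (?\<tau> (component ?h))
        \<le> perm_dist p (\<pi> ?t) (\<pi> ?h) + perm_dist p (\<pi> ?h) (?\<tau> (component ?h))"
      using perm_dist_triangle perm[OF t] perm[OF h] by blast
    moreover have "perm_dist p (\<pi> ?h) (?\<tau> (component ?h)) = perm_dist p (?\<tau> (component ?h)) (\<pi> ?h)"
      using perm_dist_commute perm[OF h] by blast
    ultimately show ?thesis
      using dist_collapse[OF p \<pi> t] dist_collapse[OF p \<pi> h] by linarith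
  qed
  have \<delta>: "0 \<le> ?\<delta>" using label_defect_nonneg[OF p \<pi>] .
  have "int (label_energy Q p ?\<tau>) \<le> (\<Sum>e\<in>arcs Q. ?d e + 4 * ?\<delta>)"
    unfolding label_energy_def of_nat_sum by (rule sum_mono) (use step in simp)
  also have "\<dots> \<le> (\<Sum>e\<in>arcs G. ?d e + 4 * ?\<delta>)"
    using \<delta> by (intro sum_mono2 finite_arcs) auto
  also have "\<dots> = int (label_energy G p \<pi>) + int (card (arcs G)) * (4 * ?\<delta>)"
    by (simp add: label_energy_def sum.distrib)
  finally show ?thesis
    by (simp add: label_defect_def algebra_simps)
qed

text \<open>
  The labels of the terminals are prescribed; the label of any other vertex lies within distance \<open>2 \<delta>\<close> of
  the label of its component.
\<close>

lemma card_collapse_fibre: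
  assumes p: "p \<ge> 1" and \<tau>: "\<tau> \<in> labelings Q (component b) (component a) p"
  shows "card {\<pi> \<in> labelings G b a p. label_defect G s p \<pi> = int \<delta> \<and> collapse \<pi> = \<tau>}
    \<le> p ^ (4 * card (verts G - {b, a}) * \<delta>)"
proof -
  define X where "X u = (if u = b then {id} else if u = a then {full_cycle p}
      else {\<sigma>. \<sigma> permutes {1..p} \<and> perm_dist p (\<tau> (component u)) \<sigma> \<le> 2 * \<delta>})" for u
  have fin: "finite (X u)" for u
    unfolding X_def using finite_subset[OF _ finite_perms[of p]] by auto
  have "{\<pi> \<in> labelings G b a p. label_defect G s p \<pi> = int \<delta> \<and> collapse \<pi> = \<tau>} \<subseteq> PiE (verts G) X"
  proof clarify
    fix \<pi> assume \<pi>: "\<pi> \<in> labelings G b a p" and \<delta>: "label_defect G s p \<pi> = int \<delta>" and "\<tau> = collapse \<pi>"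
    then have "perm_dist p (\<tau> (component u)) (\<pi> u) \<le> 2 * \<delta>" if "u \<in> verts G" for u
      using dist_collapse[OF p \<pi> that] by simp
    then show "\<pi> \<in> PiE (verts G) X"
      using \<pi> unfolding labelings_def X_def by (auto simp: PiE_iff)
  qed
  then have "card {\<pi> \<in> labelings G b a p. label_defect G s p \<pi> = int \<delta> \<and> collapse \<pi> = \<tau>}
      \<le> card (PiE (verts G) X)"
    using fin by (intro card_mono finite_PiE finite_verts)
  also have "\<dots> = (\<Prod>u\<in>verts G. card (X u))"
    by (rule card_PiE[OF finite_verts])
  also have "\<dots> = (\<Prod>u\<in>verts G - {b, a}. card (X u))"
    by (rule prod.mono_neutral_right[OF finite_verts]) (auto simp: X_def)
  also have "\<dots> \<le> (\<Prod>u\<in>verts G - {b, a}. p ^ (2 * (2 * \<delta>)))"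
  proof (rule prod_mono, intro conjI)
    fix u assume u: "u \<in> verts G - {b, a}"
    then have "\<tau> (component u) permutes {1..p}"
      using labelings_permutes[OF \<tau> flow_component_in_verts_Q] by blast
    then show "card (X u) \<le> p ^ (2 * (2 * \<delta>))"
      using u card_perm_dist_ball[OF p, of "\<tau> (component u)" "2 * \<delta>"] unfolding X_def by simp
  qed simp
  also have "\<dots> = p ^ (4 * card (verts G - {b, a}) * \<delta>)"
    by (simp add: mult_ac flip: power_mult)
  finally show ?thesis .
qed

lemma defect_count_le:
  assumes p: "p \<ge> 1"
  shows "defect_count G b a s p \<delta>
    \<le> card {\<tau> \<in> labelings Q (component b) (component a) p. label_defect Q s p \<tau> \<le> int ((1 + 4 * card (arcs G)) * \<delta>)}
        * p ^ (4 * card (verts G - {b, a}) * \<delta>)"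
    (is "_ \<le> card ?T * _")
  unfolding defect_count_def
proof (rule card_le_card_mult_fibres)
  show "finite {\<pi> \<in> labelings G b a p. label_defect G s p \<pi> = int \<delta>}" "finite ?T"
    using finite_labelings Q.finite_labelings by simp_all
  show "collapse ` {\<pi> \<in> labelings G b a p. label_defect G s p \<pi> = int \<delta>} \<subseteq> ?T"
  proof clarify
    fix \<pi> assume "\<pi> \<in> labelings G b a p" "label_defect G s p \<pi> = int \<delta>"
    then show "collapse \<pi> \<in> labelings Q (component b) (component a) p \<and>
        label_defect Q s p (collapse \<pi>) \<le> int ((1 + 4 * card (arcs G)) * \<delta>)"
      using collapse_in_labelings label_defect_collapse[OF p, of \<pi>] by (simp add: distrib_right)
  qed
  show "card {\<pi> \<in> {\<pi> \<in> labelings G b a p. label_defect G s p \<pi> = int \<delta>}. collapse \<pi> = \<tau>}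
      \<le> p ^ (4 * card (verts G - {b, a}) * \<delta>)" if "\<tau> \<in> ?T" for \<tau>
    using card_collapse_fibre[OF p, of \<tau> \<delta>] that by (simp add: conj_assoc)
qed

text \<open>
  The coefficient bound \<open>defect_count_le\<close>, with labelings of the quotient counted by their weight
  at \<open>M\<close>, leaves a geometric series in \<open>\<delta>\<close> of ratio \<open>p ^ (4 v) M ^ (1 + 4 R) / N\<close>.
\<close>

theorem moment_poly_le_flow_quotient:
  assumes p: "p \<ge> 1" and M: "M \<ge> 1"
    and N: "p ^ (4 * card (verts G - {b, a})) * M ^ (1 + 4 * card (arcs G)) < N"
  shows "moment_poly G b a s p N \<le> moment_poly Q (component b) (component a) s p M
    / (1 - real (p ^ (4 * card (verts G - {b, a})) * M ^ (1 + 4 * card (arcs G))) / real N)"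
proof -
  define v where "v = card (verts G - {b, a})"
  define C where "C = 1 + 4 * card (arcs G)"
  define K where "K = p ^ (4 * v) * M ^ C"
  let ?FQ = "moment_poly Q (component b) (component a) s p M"
  have KN: "K < N" using N by (simp only: K_def v_def C_def)
  have term_le: "real (defect_count G b a s p \<delta>) / real N ^ \<delta> \<le> ?FQ * (real K / real N) ^ \<delta>" for \<delta>
  proof -
    let ?T = "{\<tau> \<in> labelings Q (component b) (component a) p. label_defect Q s p \<tau> \<le> int (C * \<delta>)}"
    have "real (defect_count G b a s p \<delta>) \<le> real (card ?T * p ^ (4 * v * \<delta>))"
      using defect_count_le[OF p, of \<delta>] unfolding v_def C_def of_nat_le_iff .
    also have "\<dots> = real (card ?T) * real p ^ (4 * v * \<delta>)"
      by simp
    also have "\<dots> \<le> (real M ^ (C * \<delta>) * ?FQ) * real p ^ (4 * v * \<delta>)"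
      using Q.card_label_defect_le_moment_poly[OF M label_defect_Q_nonneg[OF p],
          where k = "C * \<delta>" and b = "component b" and a = "component a"]
      by (intro mult_right_mono) simp_all
    also have "\<dots> = ?FQ * real K ^ \<delta>"
      by (simp add: K_def power_mult_distrib flip: power_mult)
    finally show ?thesis
      by (simp add: power_divide divide_right_mono)
  qed
  have ratio: "norm (real K / real N) < 1" using KN by simp
  have "moment_poly G b a s p N \<le> (\<Sum>\<delta>. ?FQ * (real K / real N) ^ \<delta>)"
    unfolding moment_poly_def[of G]
    by (intro suminf_le term_le summable_moment_poly summable_mult summable_geometric ratio)
  also have "\<dots> = ?FQ * (1 / (1 - real K / real N))"
    by (simp add: suminf_mult[OF summable_geometric[OF ratio]] suminf_geometric[OF ratio])
  finally show ?thesis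
    unfolding K_def v_def C_def by simp
qed

end

section \<open>Augmented tensor networks\<close>

lemma augmented_simps [simp]:
  "verts (augmented T A out_at B in_at) = Tensor ` verts T \<union> {Term_a, Term_b}"
  "arcs (augmented T A out_at B in_at) = Internal ` arcs T \<union> Out_Leg ` A \<union> In_Leg ` B"
  by (simp_all add: augmented_def)

lemma (in tensor_network) fin_digraph_augmented: "fin_digraph (augmented T A out_at B in_at)"
proof
  let ?G = "augmented T A out_at B in_at"
  show "tail ?G e \<in> verts ?G" "head ?G e \<in> verts ?G" if "e \<in> arcs ?G" for e
    using that out_at_verts in_at_verts by (auto simp: augmented_def)
  show "finite (verts ?G)" "finite (arcs ?G)"
    using finite_legs by simp_all
qed

theorem theorem10p5:
  fixes T :: "('v, 'e) pre_digraph"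
    and A :: "'o set" and out_at :: "'o \<Rightarrow> 'v"
    and B :: "'i set" and in_at :: "'i \<Rightarrow> 'v"
    and G :: "('v aug_vert, ('e, 'o, 'i) aug_edge) pre_digraph"
    and Q :: "('v aug_vert set, ('e, 'o, 'i) aug_edge) pre_digraph"
    and P :: "(('e, 'o, 'i) aug_edge \<times> bool) list set"
    and v R s p :: nat
    and F_G F_Q :: "nat \<Rightarrow> nat \<Rightarrow> real"
  assumes "tensor_network T A out_at B in_at"
    and "G = augmented T A out_at B in_at"
    and "v = card (verts T)"
    and "R = card (arcs G)"
    and "s = min_cut G Term_b Term_a"
    and "edge_disjoint_paths G Term_b Term_a P" and "card P = s"
    and "Q = flow_quotient G P"
    and "F_G = moment_poly G Term_b Term_a s"
    and "F_Q = moment_poly Q (flow_component G P Term_b) (flow_component G P Term_a) s"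
    and "p \<ge> 2"
  shows "(\<forall>M N. M \<ge> 1 \<longrightarrow> N \<ge> 1 \<longrightarrow> p ^ (4 * v) * M ^ (1 + 4 * R) < N \<longrightarrow>
            F_G p N \<le> F_Q p M / (1 - real (p ^ (4 * v) * M ^ (1 + 4 * R)) / real N))
       \<and> (\<forall>N. N > p ^ (4 * v + 2 + 8 * R) \<longrightarrow>
            F_G p N \<le> F_Q p (p ^ 2) / (1 - real (p ^ (4 * v + 2 + 8 * R)) / real N))"
proof -
  interpret tensor_network T A out_at B in_at by (rule assms(1))
  interpret G: fin_digraph G unfolding assms(2) by (rule fin_digraph_augmented)
  interpret maximum_flow G Term_b Term_a P
    using assms(2,5-7) by unfold_locales simp_all
  have "verts G - {Term_b, Term_a} = Tensor ` verts T"
    unfolding assms(2) by auto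
  then have v: "card (verts G - {Term_b, Term_a}) = v"
    unfolding assms(3) by (simp add: card_image inj_on_def)
  have bound: "F_G p N \<le> F_Q p M / (1 - real (p ^ (4 * v) * M ^ (1 + 4 * R)) / real N)"
    if "M \<ge> 1" "p ^ (4 * v) * M ^ (1 + 4 * R) < N" for M N
    using moment_poly_le_flow_quotient[of p M N] that assms(11)
    unfolding v assms(4,5,8-10) by simp
  have K: "p ^ (4 * v) * (p ^ 2) ^ (1 + 4 * R) = p ^ (4 * v + 2 + 8 * R)"
    unfolding power_mult[symmetric] power_add[symmetric] by (simp add: algebra_simps)
  have "F_G p N \<le> F_Q p (p ^ 2) / (1 - real (p ^ (4 * v + 2 + 8 * R)) / real N)"
    if "N > p ^ (4 * v + 2 + 8 * R)" for N
    using bound[of "p ^ 2" N] that assms(11) unfolding K by simp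
  with bound show ?thesis by blast
qed

end
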